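(* Let $r,r'\in\mathbb{Z}_2$ and let $s\geq 1$ be an integer. Then there are $D_4$-module isomorphisms $$V(r)\otimes\Omega^sV(r')\cong\Omega^sV(r+r'),\qquad V(r)\otimes\Omega^{-s}V(r')\cong\Omega^{-s}V(r+r').$$
   Context: Let $k$ be an algebraically closed field with $\mathrm{char}(k)\neq 2$. All modules are finite-dimensional left modules; $\otimes=\otimes_k$; $\mathbb{Z}_2=\mathbb{Z}/2\mathbb{Z}$. $D_4$ is the $k$-algebra generated by $a,b,c,d$ subject to $ba=-ab$, $db=-bd$, $ca=-ac$, $dc=-cd$, $bc=cb$, $a^2=0$, $b^2=1$, $c^2=1$, $d^2=0$, $da+ad=1-bc$. It is a $16$-dimensional Hopf algebra (isomorphic to the Drinfeld double of Sweedler's 4-dimensional Hopf algebra) with comultiplication $\Delta(a)=a\otimes b+1\otimes a$, $\Delta(b)=b\otimes b$, $\Delta(c)=c\otimes c$, $\Delta(d)=d\otimes c+1\otimes d$, counit $\varepsilon(a)=\varepsilon(d)=0$, $\varepsilon(b)=\varepsilon(c)=1$, antipode $S(a)=-ab$, $S(b)=b$, $S(c)=c$, $S(d)=-dc$. Tensor products of $D_4$-modules are $D_4$-modules via $\Delta$. For $r\in\mathbb{Z}_2$, $V(r)$ is the one-dimensional simple module on which $a,d$ act as $0$ and $b,c$ act as $(-1)^r$. For a module $M$, $\Omega M$ is the kernel of a projective cover $P(M)\to M$ and $\Omega^{-1}M$ is the cokernel of an injective envelope $M\to I(M)$; for $s\geq1$, $\Omega^{s}$ and $\Omega^{-s}$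 are the $s$-fold iterates of $\Omega$ and $\Omega^{-1}$. *)

theory Defs
  imports
    "Jordan_Normal_Form.Matrix_Kernel"
    "HOL-Library.Z2"
begin

text \<open>
  A left module over an algebra given by generators and relations is a vector space together with
  one linear operator per generator, such that the operators satisfy the defining relations.
  All modules are finite-dimensional, so up to isomorphism the underlying space is \<open>k\<^sup>n\<close>
  (column vectors, \<^term>\<open>carrier_vec n\<close>; \<open>n = 0\<close> is allowed), and the operators are \<open>n \<times> n\<close>
  matrices. The \<open>D\<^sub>4\<close>-modules below are exactly the modules with underlying space some \<open>k\<^sup>n\<close>;
  every finite-dimensional module is isomorphic to one of these, so quantifying over them amounts
  to quantifying over all finite-dimensional modules.
\<close>

record 'k d4rep =
  mdim :: nat
  actA :: "'k mat"
  actB :: "'k mat"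
  actC :: "'k mat"
  actD :: "'k mat"

abbreviation space :: "'k d4rep \<Rightarrow> 'k vec set" where
  "space M \<equiv> carrier_vec (mdim M)"

definition D4_module :: "'k::field d4rep \<Rightarrow> bool" where
  "D4_module M \<longleftrightarrow>
     (let n = mdim M; a = actA M; b = actB M; c = actC M; d = actD M in
        a \<in> carrier_mat n n \<and> b \<in> carrier_mat n n \<and> c \<in> carrier_mat n n \<and> d \<in> carrier_mat n n \<and>
        b * a = - (a * b) \<and>
        d * b = - (b * d) \<and>
        c * a = - (a * c) \<and>
        d * c = - (c * d) \<and>
        b * c = c * b \<and>
        a * a = 0\<^sub>m n n \<and>
        b * b = 1\<^sub>m n \<and>
        c * c = 1\<^sub>m n \<and>
        d * d = 0\<^sub>m n n \<and>
        d * a + a * d = 1\<^sub>m n - b * c)"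

definition D4_hom :: "'k::field d4rep \<Rightarrow> 'k d4rep \<Rightarrow> 'k mat \<Rightarrow> bool" where
  "D4_hom M N f \<longleftrightarrow>
     f \<in> carrier_mat (mdim N) (mdim M) \<and>
     f * actA M = actA N * f \<and>
     f * actB M = actB N * f \<and>
     f * actC M = actC N * f \<and>
     f * actD M = actD N * f"

definition D4_iso :: "'k::field d4rep \<Rightarrow> 'k d4rep \<Rightarrow> bool" (infix "\<cong>\<^sub>D" 50) where
  "M \<cong>\<^sub>D N \<longleftrightarrow> D4_module M \<and> D4_module N \<and> (\<exists>f. D4_hom M N f \<and> invertible_mat f)"

definition mat_image :: "'k::field mat \<Rightarrow> 'k vec set" where
  "mat_image f = (\<lambda>v. f *\<^sub>v v) ` carrier_vec (dim_col f)"

definition surj_mat :: "'k::field mat \<Rightarrow> bool" where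
  "surj_mat f \<longleftrightarrow> mat_image f = carrier_vec (dim_row f)"

definition inj_mat :: "'k::field mat \<Rightarrow> bool" where
  "inj_mat f \<longleftrightarrow> inj_on (\<lambda>v. f *\<^sub>v v) (carrier_vec (dim_col f))"

definition D4_submodule :: "'k::field d4rep \<Rightarrow> 'k vec set \<Rightarrow> bool" where
  "D4_submodule M L \<longleftrightarrow>
     L \<subseteq> space M \<and>
     0\<^sub>v (mdim M) \<in> L \<and>
     (\<forall>u\<in>L. \<forall>v\<in>L. u + v \<in> L) \<and>
     (\<forall>t. \<forall>v\<in>L. t \<cdot>\<^sub>v v \<in> L) \<and>
     (\<forall>v\<in>L. actA M *\<^sub>v v \<in> L \<and> actB M *\<^sub>v v \<in> L \<and> actC M *\<^sub>v v \<in> L \<and> actD M *\<^sub>v v \<in> L)"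

definition D4_projective :: "'k::field d4rep \<Rightarrow> bool" where
  "D4_projective P \<longleftrightarrow> D4_module P \<and>
     (\<forall>M N g f. D4_module M \<and> D4_module N \<and> D4_hom M N g \<and> surj_mat g \<and> D4_hom P N f \<longrightarrow>
        (\<exists>h. D4_hom P M h \<and> g * h = f))"

definition D4_injective :: "'k::field d4rep \<Rightarrow> bool" where
  "D4_injective I \<longleftrightarrow> D4_module I \<and>
     (\<forall>M N g f. D4_module M \<and> D4_module N \<and> D4_hom M N g \<and> inj_mat g \<and> D4_hom M I f \<longrightarrow>
        (\<exists>h. D4_hom N I h \<and> h * g = f))"

text \<open>A projective cover is an epimorphism from a projective module with superfluous kernel; an
  injective envelope is a monomorphism into an injective module with essential image.\<close>

definition projective_cover :: "'k::field d4rep \<Rightarrow> 'k d4rep \<Rightarrow> 'k mat \<Rightarrow> bool" where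
  "projective_cover M P f \<longleftrightarrow>
     D4_module M \<and> D4_projective P \<and> D4_hom P M f \<and> surj_mat f \<and>
     (\<forall>L. D4_submodule P L \<and> {u + v | u v. u \<in> L \<and> v \<in> mat_kernel f} = space P \<longrightarrow> L = space P)"

definition injective_envelope :: "'k::field d4rep \<Rightarrow> 'k d4rep \<Rightarrow> 'k mat \<Rightarrow> bool" where
  "injective_envelope M I f \<longleftrightarrow>
     D4_module M \<and> D4_injective I \<and> D4_hom M I f \<and> inj_mat f \<and>
     (\<forall>L. D4_submodule I L \<and> L \<inter> mat_image f = {0\<^sub>v (mdim I)} \<longrightarrow> L = {0\<^sub>v (mdim I)})"

text \<open>
  \<open>\<Omega> M\<close> and \<open>\<Omega>\<^sup>-\<^sup>1 M\<close> are only determined up to isomorphism, so they are relations: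
  \<open>Syz M K\<close> says that \<open>K\<close> is a kernel of some projective cover of \<open>M\<close>, and \<open>Cosyz M K\<close> that \<open>K\<close> is a
  cokernel of some injective envelope of \<open>M\<close>. The \<open>s\<close>-fold iterates are the relational powers
  \<open>Syz ^^ s\<close> and \<open>Cosyz ^^ s\<close>. Projective covers and injective envelopes exist because the algebra
  is finite-dimensional, so every module has a (co)syzygy of each order.
\<close>

definition Syz :: "'k::field d4rep \<Rightarrow> 'k d4rep \<Rightarrow> bool" where
  "Syz M K \<longleftrightarrow> D4_module K \<and>
     (\<exists>P f i. projective_cover M P f \<and> D4_hom K P i \<and> inj_mat i \<and> mat_image i = mat_kernel f)"

definition Cosyz :: "'k::field d4rep \<Rightarrow> 'k d4rep \<Rightarrow> bool" where
  "Cosyz M K \<longleftrightarrow> D4_module K \<and>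
     (\<exists>I f q. injective_envelope M I f \<and> D4_hom I K q \<and> surj_mat q \<and> mat_kernel q = mat_image f)"

text \<open>The Kronecker product is the matrix of a tensor product of linear maps with respect to the
  lexicographically ordered basis \<open>e\<^sub>i \<otimes> e\<^sub>j\<close>, which sits at position \<open>i * m + j\<close> if the second
  factor has dimension \<open>m\<close>.\<close>

definition kron :: "'k::field mat \<Rightarrow> 'k mat \<Rightarrow> 'k mat" (infixl "\<otimes>\<^sub>k" 70) where
  "X \<otimes>\<^sub>k Y = mat (dim_row X * dim_row Y) (dim_col X * dim_col Y)
     (\<lambda>(i, j). X $$ (i div dim_row Y, j div dim_col Y) * Y $$ (i mod dim_row Y, j mod dim_col Y))"

text \<open>The action on a tensor product is through the comultiplication
  \<open>\<Delta> a = a \<otimes> b + 1 \<otimes> a\<close>, \<open>\<Delta> b = b \<otimes> b\<close>, \<open>\<Delta> c = c \<otimes> c\<close>, \<open>\<Delta> d = d \<otimes> c + 1 \<otimes> d\<close>.\<close>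

definition D4_tensor :: "'k::field d4rep \<Rightarrow> 'k d4rep \<Rightarrow> 'k d4rep" (infixl "\<otimes>\<^sub>D" 70) where
  "M \<otimes>\<^sub>D N =
     \<lparr> mdim = mdim M * mdim N,
       actA = actA M \<otimes>\<^sub>k actB N + 1\<^sub>m (mdim M) \<otimes>\<^sub>k actA N,
       actB = actB M \<otimes>\<^sub>k actB N,
       actC = actC M \<otimes>\<^sub>k actC N,
       actD = actD M \<otimes>\<^sub>k actC N + 1\<^sub>m (mdim M) \<otimes>\<^sub>k actD N \<rparr>"

text \<open>The type \<^typ>\<open>bit\<close> is the integers modulo 2; \<open>sgn_bit r\<close> is \<open>(-1)\<^sup>r\<close>.\<close>

definition sgn_bit :: "bit \<Rightarrow> 'k::field" where
  "sgn_bit r = (if r = 0 then 1 else - 1)"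

definition V :: "bit \<Rightarrow> 'k::field d4rep" where
  "V r = \<lparr> mdim = 1, actA = 0\<^sub>m 1 1, actB = sgn_bit r \<cdot>\<^sub>m 1\<^sub>m 1, actC = sgn_bit r \<cdot>\<^sub>m 1\<^sub>m 1, actD = 0\<^sub>m 1 1 \<rparr>"

lemma D4_module_V: "D4_module (V r :: 'k::field d4rep)"
  unfolding D4_module_def V_def Let_def sgn_bit_def by (auto intro!: eq_matI simp: scalar_prod_def)

end

theory Submission
  imports Defs "Jordan_Normal_Form.Determinant"
begin

text \<open>
  Since \<open>a\<close> and \<open>d\<close> act as zero on \<open>V(r)\<close>, the module \<open>V(r) \<otimes> M\<close> is \<open>M\<close> with the actions of
  \<open>b\<close> and \<open>c\<close> multiplied by \<open>(-1)\<^sup>r\<close>. This twist is an involution that changes neither the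
  homomorphisms nor the submodules, so it carries projective covers to projective covers and
  injective envelopes to injective envelopes, hence syzygies to syzygies. It remains to see that
  (co)syzygies are unique up to isomorphism. If \<open>P\<close> and \<open>Q\<close> are projective covers of the same
  module, lifting gives epimorphisms \<open>P \<rightarrow> Q\<close> and \<open>Q \<rightarrow> P\<close>; so the dimensions agree, both are
  isomorphisms, and they restrict to the kernels. Injective envelopes are dual.
\<close>

section \<open>Injective and surjective matrices\<close>

lemma mult_mat_unit_vec:
  fixes A :: "'k::field mat"
  assumes "A \<in> carrier_mat n m" "k < m"
  shows "A *\<^sub>v unit_vec m k = col A k"
  using assms by (intro eq_vecI) (auto simp: scalar_prod_right_unit)

lemma mat_eq_if_mult_vec_eq:
  fixes A B :: "'k::field mat"
  assumes "A \<in> carrier_mat n m" "B \<in> carrier_mat n m"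
    and "\<And>v. v \<in> carrier_vec m \<Longrightarrow> A *\<^sub>v v = B *\<^sub>v v"
  shows "A = B"
proof (rule eq_matI)
  fix i j assume ij: "i < dim_row B" "j < dim_col B"
  then have "A *\<^sub>v unit_vec m j = B *\<^sub>v unit_vec m j"
    using assms by auto
  then have "col A j = col B j"
    using ij assms(1,2) mult_mat_unit_vec[OF assms(1), of j] mult_mat_unit_vec[OF assms(2), of j] by auto
  then have "col A j $ i = col B j $ i"
    by simp
  then show "A $$ (i, j) = B $$ (i, j)"
    using ij assms(1,2) by auto
qed (use assms in auto)

lemma inj_matD:
  assumes "inj_mat j" "j \<in> carrier_mat n m" "u \<in> carrier_vec m" "v \<in> carrier_vec m"
    "j *\<^sub>v u = j *\<^sub>v v"
  shows "u = v"
  using assms unfolding inj_mat_def inj_on_def by auto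

lemma inj_mat_if_kernel_trivial:
  fixes j :: "'k::field mat"
  assumes j: "j \<in> carrier_mat n m"
    and triv: "\<And>v. v \<in> carrier_vec m \<Longrightarrow> j *\<^sub>v v = 0\<^sub>v n \<Longrightarrow> v = 0\<^sub>v m"
  shows "inj_mat j"
  unfolding inj_mat_def
proof (rule inj_onI)
  fix u v assume "u \<in> carrier_vec (dim_col j)" "v \<in> carrier_vec (dim_col j)"
    and e: "j *\<^sub>v u = j *\<^sub>v v"
  then have uv: "u \<in> carrier_vec m" "v \<in> carrier_vec m"
    using j by auto
  have "j *\<^sub>v (u - v) = 0\<^sub>v n"
    using mult_minus_distrib_mat_vec[OF j uv] e j uv by simp
  then have "u - v = 0\<^sub>v m"
    using triv uv by simp
  then have "u - v + v = v"
    using uv by simp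
  moreover have "u - v + v = u"
    using uv by (intro eq_vecI) auto
  ultimately show "u = v" by simp
qed

text \<open>Identities between maps into a kernel are checked after composing with its inclusion.
  \<open>surj_mat_cancel\<close> does the same for maps out of a cokernel.\<close>

lemma inj_mat_cancel:
  fixes j :: "'k::field mat"
  assumes "inj_mat j" and j: "j \<in> carrier_mat n m"
    and x: "x \<in> carrier_mat m l" and y: "y \<in> carrier_mat m l" and "j * x = j * y"
  shows "x = y"
proof (rule mat_eq_if_mult_vec_eq[OF x y])
  fix v :: "'k vec" assume v: "v \<in> carrier_vec l"
  have "j *\<^sub>v (x *\<^sub>v v) = j *\<^sub>v (y *\<^sub>v v)"
    using assoc_mult_mat_vec[OF j x v] assoc_mult_mat_vec[OF j y v] assms(5) by simp
  then show "x *\<^sub>v v = y *\<^sub>v v"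
    using inj_matD[OF assms(1) j] x y v by simp
qed

text \<open>The columns of \<open>x\<close> are chosen preimages under \<open>j\<close> of the
  columns of \<open>u\<close>. With \<open>j\<close> the inclusion of a kernel, this is the
  existence half of the universal property of the kernel, on the level of linear maps.\<close>

lemma factor_through_image:
  fixes j u :: "'k::field mat"
  assumes j: "j \<in> carrier_mat n m" and u: "u \<in> carrier_mat n l"
    and im: "\<And>v. v \<in> carrier_vec l \<Longrightarrow> u *\<^sub>v v \<in> mat_image j"
  obtains x where "x \<in> carrier_mat m l" "j * x = u"
proof -
  have "\<exists>w. w \<in> carrier_vec m \<and> j *\<^sub>v w = col u k" if "k < l" for k
    using im[of "unit_vec l k"] mult_mat_unit_vec[OF u that] that j
    unfolding mat_image_def by auto
  then obtain w where w: "\<And>k. k < l \<Longrightarrow> w k \<in> carrier_vec m \<and> j *\<^sub>v w k = col u k"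
    by metis
  define x where "x = mat_of_cols m (map w [0..<l])"
  have x: "x \<in> carrier_mat m l"
    unfolding x_def by auto
  have "j * x = u"
  proof (rule eq_matI)
    fix i k assume ik: "i < dim_row u" "k < dim_col u"
    then have k: "k < l" and i: "i < n"
      using u by auto
    have "col x k = w k"
      using w[OF k] k unfolding x_def by simp
    then have "(j * x) $$ (i, k) = (j *\<^sub>v w k) $ i"
      using i k j x by simp
    then show "(j * x) $$ (i, k) = u $$ (i, k)"
      using w[OF k] i k u by simp
  qed (use j x u in auto)
  then show thesis
    using that x by blast
qed

lemma surj_matD:
  assumes "surj_mat f" "f \<in> carrier_mat n m" "w \<in> carrier_vec n"
  obtains v where "v \<in> carrier_vec m" "f *\<^sub>v v = w"
proof -
  have "w \<in> (\<lambda>v. f *\<^sub>v v) ` carrier_vec m"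
    using assms unfolding surj_mat_def mat_image_def by auto
  then show thesis
    using that by blast
qed

text \<open>The identity factors through a surjective matrix. The section \<open>s\<close> is only
  linear; even if \<open>f\<close> is a homomorphism of modules, \<open>s\<close> need not be
  one.\<close>

lemma surj_mat_right_inverse:
  fixes f :: "'k::field mat"
  assumes "surj_mat f" "f \<in> carrier_mat n m"
  obtains s where "s \<in> carrier_mat m n" "f * s = 1\<^sub>m n"
proof (rule factor_through_image[OF assms(2), of "1\<^sub>m n" n])
  show "1\<^sub>m n *\<^sub>v v \<in> mat_image f" if "v \<in> carrier_vec n" for v
    using assms that unfolding surj_mat_def by auto
qed (use that in auto)

lemma surj_mat_cancel:
  fixes q :: "'k::field mat"
  assumes "surj_mat q" and q: "q \<in> carrier_mat n m"
    and x: "x \<in> carrier_mat l n" and y: "y \<in> carrier_mat l n" and "x * q = y * q"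
  shows "x = y"
proof -
  obtain s where s: "s \<in> carrier_mat m n" "q * s = 1\<^sub>m n"
    using surj_mat_right_inverse[OF assms(1) q] .
  have "x = x * q * s"
    using assoc_mult_mat[OF x q s(1)] s x by simp
  also have "\<dots> = y"
    using assoc_mult_mat[OF y q s(1)] s y assms(5) by simp
  finally show ?thesis .
qed

lemma inj_mat_dim_le:
  fixes f :: "'k::field mat"
  assumes "inj_mat f" and f: "f \<in> carrier_mat n m"
  shows "m \<le> n"
proof (rule ccontr)
  assume "\<not> m \<le> n"
  then have nm: "n < m" by simp
  \<comment> \<open>Pad \<open>f\<close> with zero rows to a singular square matrix.\<close>
  define F where "F = mat m m (\<lambda>(i, k). if i < n then f $$ (i, k) else 0)"
  have F: "F \<in> carrier_mat m m"
    unfolding F_def by simp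
  \<comment> \<open>Row \<open>n\<close> is the first padded row and exists because
    \<open>n < m\<close>. It is column \<open>n\<close> of the transpose, which therefore has a
    nontrivial kernel.\<close>
  have "F\<^sup>T *\<^sub>v unit_vec m n = 0\<^sub>v m"
    using mult_mat_unit_vec[of "F\<^sup>T" m m n] F nm by (auto simp: F_def)
  moreover have "unit_vec m n \<noteq> (0\<^sub>v m :: 'k vec)"
    using nm by (metis index_unit_vec(2) index_zero_vec(1) zero_neq_one)
  ultimately have "det (F\<^sup>T) = 0"
    using det_0_iff_vec_prod_zero_field[of "F\<^sup>T" m] F unit_vec_carrier[of m n]
    by (metis transpose_carrier_mat)
  then have "det F = 0"
    using det_transpose[OF F] by simp
  then obtain v where v: "v \<in> carrier_vec m" "v \<noteq> 0\<^sub>v m" "F *\<^sub>v v = 0\<^sub>v m"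
    using det_0_iff_vec_prod_zero_field[OF F] by auto
  have "f *\<^sub>v v = 0\<^sub>v n"
  proof (rule eq_vecI)
    fix i assume i: "i < dim_vec (0\<^sub>v n :: 'k vec)"
    then have "row f i = row F i"
      using f nm by (auto simp: F_def)
    then have "(f *\<^sub>v v) $ i = (F *\<^sub>v v) $ i"
      using i f F nm by simp
    then show "(f *\<^sub>v v) $ i = 0\<^sub>v n $ i"
      using v i nm by simp
  qed (use f in simp)
  moreover have "f *\<^sub>v 0\<^sub>v m = 0\<^sub>v n"
    using f by auto
  ultimately show False
    using inj_matD[OF assms(1) f v(1), of "0\<^sub>v m"] v by simp
qed

lemma inj_mat_if_left_inverse:
  fixes x y :: "'k::field mat"
  assumes x: "x \<in> carrier_mat n m" and y: "y \<in> carrier_mat m n" and "x * y = 1\<^sub>m n"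
  shows "inj_mat y"
  unfolding inj_mat_def
proof (rule inj_on_inverseI)
  fix v :: "'k vec" assume "v \<in> carrier_vec (dim_col y)"
  then show "x *\<^sub>v (y *\<^sub>v v) = v"
    using assms assoc_mult_mat_vec[OF x y, of v] by simp
qed

text \<open>A right inverse of \<open>f\<close> has \<open>f\<close> as a left inverse, so it is
  injective and the bound for injective matrices applies to it.\<close>

lemma surj_mat_dim_le:
  fixes f :: "'k::field mat"
  assumes "surj_mat f" "f \<in> carrier_mat n m"
  shows "n \<le> m"
  using surj_mat_right_inverse[OF assms] inj_mat_if_left_inverse inj_mat_dim_le assms(2) by metis

lemma surj_mat_square_inverse:
  fixes f :: "'k::field mat"
  assumes "surj_mat f" "f \<in> carrier_mat n n"
  obtains g where "g \<in> carrier_mat n n" "f * g = 1\<^sub>m n" "g * f = 1\<^sub>m n"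
  using surj_mat_right_inverse[OF assms] mat_mult_left_right_inverse assms(2) by metis

text \<open>A trivial kernel forces a nonzero determinant, hence a unit in the ring of square
  matrices.\<close>

lemma inj_mat_square_inverse:
  fixes f :: "'k::field mat"
  assumes "inj_mat f" and f: "f \<in> carrier_mat n n"
  obtains g where "g \<in> carrier_mat n n" "f * g = 1\<^sub>m n" "g * f = 1\<^sub>m n"
proof -
  have "f *\<^sub>v 0\<^sub>v n = 0\<^sub>v n"
    using f by auto
  then have "det f \<noteq> 0"
    using det_0_iff_vec_prod_zero_field[OF f] inj_matD[OF assms(1) f, of _ "0\<^sub>v n"] by auto
  then have "f \<in> Units (ring_mat TYPE('k) n ())"
    by (rule det_non_zero_imp_unit[OF f])
  then show thesis
    using that unfolding Units_def ring_mat_simps by auto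
qed

section \<open>Homomorphisms and isomorphisms\<close>

lemma D4_module_carrier:
  assumes "D4_module M"
  shows "actA M \<in> carrier_mat (mdim M) (mdim M)" "actB M \<in> carrier_mat (mdim M) (mdim M)"
    "actC M \<in> carrier_mat (mdim M) (mdim M)" "actD M \<in> carrier_mat (mdim M) (mdim M)"
  using assms unfolding D4_module_def Let_def by auto

lemma D4_hom_carrier: "D4_hom M N f \<Longrightarrow> f \<in> carrier_mat (mdim N) (mdim M)"
  unfolding D4_hom_def by simp

text \<open>The intertwining lemmas treat one operator at a time: \<open>A\<close>,
  \<open>B\<close>, \<open>C\<close> stand for the actions of the same generator on the modules
  involved. The statements on \<open>D4_hom\<close> use them once for each of the four
  generators.\<close>

lemma intertwine_comp:
  fixes f g :: "'k::field mat"
  assumes "f \<in> carrier_mat n m" "g \<in> carrier_mat l n"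
    "A \<in> carrier_mat m m" "B \<in> carrier_mat n n" "C \<in> carrier_mat l l"
    "f * A = B * f" "g * B = C * g"
  shows "(g * f) * A = C * (g * f)"
proof -
  have "(g * f) * A = g * (B * f)"
    using assms(6) assoc_mult_mat[OF assms(2,1,3)] by simp
  also have "\<dots> = C * g * f"
    using assms(7) assoc_mult_mat[OF assms(2,4,1)] by simp
  also have "\<dots> = C * (g * f)"
    by (rule assoc_mult_mat[OF assms(5,2,1)])
  finally show ?thesis .
qed

lemma D4_hom_comp:
  assumes "D4_module M" "D4_module N" "D4_module L" "D4_hom M N f" "D4_hom N L g"
  shows "D4_hom M L (g * f)"
  using assms(4,5) intertwine_comp[OF D4_hom_carrier[OF assms(4)] D4_hom_carrier[OF assms(5)]]
    D4_module_carrier[OF assms(1)] D4_module_carrier[OF assms(2)] D4_module_carrier[OF assms(3)]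
  unfolding D4_hom_def by (auto intro: mult_carrier_mat)

lemma intertwine_lift:
  fixes j u :: "'k::field mat"
  assumes inj: "inj_mat j" and j: "j \<in> carrier_mat q l" and x: "x \<in> carrier_mat l m"
    and u: "j * x = u"
    and A: "A \<in> carrier_mat m m" and B: "B \<in> carrier_mat l l" and C: "C \<in> carrier_mat q q"
    and uA: "u * A = C * u" and jB: "j * B = C * j"
  shows "x * A = B * x"
proof (rule inj_mat_cancel[OF inj j])
  have "j * (x * A) = C * (j * x)"
    using uA assoc_mult_mat[OF j x A] u by simp
  also have "\<dots> = j * (B * x)"
    using jB assoc_mult_mat[OF C j x] assoc_mult_mat[OF j B x] by simp
  finally show "j * (x * A) = j * (B * x)" .
qed (use x A B in auto)

text \<open>If a homomorphism factors linearly through a monomorphism of modules, the factor is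
  automatically a homomorphism: compare both sides after composing with \<open>j\<close> and cancel.
  This turns the purely linear factorization through a kernel into one of modules.\<close>

lemma D4_hom_lift:
  assumes "D4_module K" "D4_module L" "D4_module Q" "D4_hom K Q u" "D4_hom L Q j" "inj_mat j"
    "x \<in> carrier_mat (mdim L) (mdim K)" "j * x = u"
  shows "D4_hom K L x"
  using assms(4,5,7) intertwine_lift[OF assms(6) D4_hom_carrier[OF assms(5)] assms(7,8)]
    D4_module_carrier[OF assms(1)] D4_module_carrier[OF assms(2)] D4_module_carrier[OF assms(3)]
  unfolding D4_hom_def by auto

lemma intertwine_descend:
  fixes q u :: "'k::field mat"
  assumes surj: "surj_mat q" and q: "q \<in> carrier_mat m p" and x: "x \<in> carrier_mat l m"
    and u: "x * q = u"
    and A: "A \<in> carrier_mat m m" and B: "B \<in> carrier_mat l l" and C: "C \<in> carrier_mat p p"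
    and uC: "u * C = B * u" and qC: "q * C = A * q"
  shows "x * A = B * x"
proof (rule surj_mat_cancel[OF surj q])
  have "x * A * q = x * q * C"
    using qC assoc_mult_mat[OF x A q] assoc_mult_mat[OF x q C] by simp
  also have "\<dots> = B * x * q"
    using u uC assoc_mult_mat[OF B x q] by simp
  finally show "x * A * q = B * x * q" .
qed (use x A B in auto)

text \<open>Dual to \<open>D4_hom_lift\<close>: the factor of a homomorphism through an epimorphism
  is a homomorphism, since the epimorphism cancels on the right.\<close>

lemma D4_hom_descend:
  assumes "D4_module K" "D4_module L" "D4_module I" "D4_hom I L u" "D4_hom I K q" "surj_mat q"
    "x \<in> carrier_mat (mdim L) (mdim K)" "x * q = u"
  shows "D4_hom K L x"
  using assms(4,5,7) intertwine_descend[OF assms(6) D4_hom_carrier[OF assms(5)] assms(7,8)]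
    D4_module_carrier[OF assms(1)] D4_module_carrier[OF assms(2)] D4_module_carrier[OF assms(3)]
  unfolding D4_hom_def by auto

text \<open>The identity of \<open>N\<close> is \<open>f * g\<close> with \<open>f\<close> a
  monomorphism, so \<open>g\<close> is a lift in the sense of \<open>D4_hom_lift\<close>.\<close>

lemma D4_hom_inverse:
  assumes "D4_module M" "D4_module N" "D4_hom M N f"
    "g \<in> carrier_mat (mdim M) (mdim N)" "f * g = 1\<^sub>m (mdim N)" "g * f = 1\<^sub>m (mdim M)"
  shows "D4_hom N M g"
proof (rule D4_hom_lift[OF assms(2,1,2) _ assms(3) _ assms(4,5)])
  show "D4_hom N N (1\<^sub>m (mdim N))"
    using D4_module_carrier[OF assms(2)] unfolding D4_hom_def by auto
  show "inj_mat f"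
    by (rule inj_mat_if_left_inverse[OF assms(4) D4_hom_carrier[OF assms(3)] assms(6)])
qed

lemma D4_isoE:
  assumes "M \<cong>\<^sub>D N"
  obtains f g where "D4_module M" "D4_module N" "D4_hom M N f" "D4_hom N M g"
    "f * g = 1\<^sub>m (mdim N)" "g * f = 1\<^sub>m (mdim M)"
proof -
  obtain f where f: "D4_module M" "D4_module N" "D4_hom M N f" "invertible_mat f"
    using assms unfolding D4_iso_def by auto
  note fc = D4_hom_carrier[OF f(3)]
  obtain g where fg: "f * g = 1\<^sub>m (dim_row f)" and gf: "g * f = 1\<^sub>m (dim_row g)"
    using f(4) unfolding invertible_mat_def inverts_mat_def by auto
  \<comment> \<open>\<open>inverts_mat\<close> does not prescribe the shape of \<open>g\<close>; it
    is read off by comparing the numbers of columns in the two identities.\<close>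
  have "dim_col g = dim_row f"
    using arg_cong[OF fg, of dim_col] by simp
  moreover have "dim_row g = dim_col f"
    using arg_cong[OF gf, of dim_col] by simp
  ultimately have gc: "g \<in> carrier_mat (mdim M) (mdim N)"
    using fc by auto
  then show thesis
    using that[OF f(1,2,3)] D4_hom_inverse[OF f(1,2,3) gc] fg gf fc by auto
qed

lemma D4_isoI:
  assumes "D4_module M" "D4_module N" "D4_hom M N f"
    and g: "g \<in> carrier_mat (mdim M) (mdim N)"
    and "f * g = 1\<^sub>m (mdim N)" "g * f = 1\<^sub>m (mdim M)"
  shows "M \<cong>\<^sub>D N"
proof -
  note f = D4_hom_carrier[OF assms(3)]
  \<comment> \<open>\<open>invertible_mat\<close> demands a square matrix, so the equality of
    dimensions has to be derived from the two inverse identities.\<close>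
  have "mdim M \<le> mdim N"
    using inj_mat_dim_le[OF inj_mat_if_left_inverse[OF g f assms(6)] f] .
  moreover have "mdim N \<le> mdim M"
    using inj_mat_dim_le[OF inj_mat_if_left_inverse[OF f g assms(5)] g] .
  ultimately have "invertible_mat f"
    using f g assms(5,6) unfolding invertible_mat_def inverts_mat_def by auto
  then show ?thesis
    using assms unfolding D4_iso_def by auto
qed

lemma D4_iso_refl:
  assumes "D4_module M"
  shows "M \<cong>\<^sub>D M"
  by (rule D4_isoI[OF assms assms, of "1\<^sub>m (mdim M)" "1\<^sub>m (mdim M)"])
    (use D4_module_carrier[OF assms] in \<open>auto simp: D4_hom_def\<close>)

lemma D4_iso_sym: "M \<cong>\<^sub>D N \<Longrightarrow> N \<cong>\<^sub>D M"
  by (elim D4_isoE) (rule D4_isoI, auto dest: D4_hom_carrier)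

section \<open>Uniqueness of syzygies and cosyzygies\<close>

lemma D4_submodule_image:
  assumes P: "D4_module P" and Q: "D4_module Q" and h: "D4_hom P Q h"
  shows "D4_submodule Q (mat_image h)"
proof -
  note hc = D4_hom_carrier[OF h]
  have im: "mat_image h = (\<lambda>v. h *\<^sub>v v) ` carrier_vec (mdim P)"
    using hc unfolding mat_image_def by auto
  have act: "B *\<^sub>v (h *\<^sub>v v) \<in> mat_image h"
    if "h * A = B * h" "A \<in> carrier_mat (mdim P) (mdim P)" "B \<in> carrier_mat (mdim Q) (mdim Q)"
      "v \<in> carrier_vec (mdim P)" for A B v
  proof -
    have "B *\<^sub>v (h *\<^sub>v v) = h *\<^sub>v (A *\<^sub>v v)"
      using that assoc_mult_mat_vec[OF that(3) hc that(4)]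
        assoc_mult_mat_vec[OF hc that(2) that(4)] by simp
    then show ?thesis
      using that unfolding im by auto
  qed
  have "0\<^sub>v (mdim Q) = h *\<^sub>v 0\<^sub>v (mdim P)"
    using hc by auto
  then have zero: "0\<^sub>v (mdim Q) \<in> mat_image h"
    unfolding im by auto
  have add: "h *\<^sub>v u + h *\<^sub>v v \<in> mat_image h"
    if "u \<in> carrier_vec (mdim P)" "v \<in> carrier_vec (mdim P)" for u v
    using mult_add_distrib_mat_vec[OF hc that] that unfolding im by (metis add_carrier_vec imageI)
  have smult: "t \<cdot>\<^sub>v (h *\<^sub>v v) \<in> mat_image h" if "v \<in> carrier_vec (mdim P)" for t v
    using mult_mat_vec[OF hc that, of t] that unfolding im by (metis smult_carrier_vec imageI)
  show ?thesis
    unfolding D4_submodule_def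
    using zero add smult act D4_module_carrier[OF P] D4_module_carrier[OF Q] h hc
    unfolding D4_hom_def by (auto simp: im)
qed

lemma D4_submodule_kernel:
  assumes P: "D4_module P" and Q: "D4_module Q" and h: "D4_hom P Q h"
  shows "D4_submodule P (mat_kernel h)"
proof -
  note hc = D4_hom_carrier[OF h]
  have act: "A *\<^sub>v v \<in> mat_kernel h"
    if "h * A = B * h" "A \<in> carrier_mat (mdim P) (mdim P)" "B \<in> carrier_mat (mdim Q) (mdim Q)"
      "v \<in> mat_kernel h" for A B v
  proof -
    note v = mat_kernelD[OF hc that(4)]
    have "h *\<^sub>v (A *\<^sub>v v) = B *\<^sub>v (h *\<^sub>v v)"
      using that assoc_mult_mat_vec[OF that(3) hc v(1)]
        assoc_mult_mat_vec[OF hc that(2) v(1)] by simp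
    also have "\<dots> = 0\<^sub>v (mdim Q)"
      using v that(3) by auto
    finally show ?thesis
      using that v by (intro mat_kernelI[OF hc]) auto
  qed
  have "0\<^sub>v (mdim P) \<in> mat_kernel h"
    using hc by (intro mat_kernelI[OF hc]) auto
  moreover have "u + v \<in> mat_kernel h" if "u \<in> mat_kernel h" "v \<in> mat_kernel h" for u v
    using mat_kernelD[OF hc that(1)] mat_kernelD[OF hc that(2)] mult_add_distrib_mat_vec[OF hc]
    by (intro mat_kernelI[OF hc]) auto
  ultimately show ?thesis
    unfolding D4_submodule_def
    using act mat_kernel_smult[OF hc] mat_kernel_carrier[OF hc]
      D4_module_carrier[OF P] D4_module_carrier[OF Q] h
    unfolding D4_hom_def by blast
qed

lemma D4_projectiveD:
  "D4_projective P \<Longrightarrow> D4_module M \<Longrightarrow> D4_module N \<Longrightarrow> D4_hom M N g \<Longrightarrow> surj_mat g \<Longrightarrow>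
    D4_hom P N f \<Longrightarrow> \<exists>h. D4_hom P M h \<and> g * h = f"
  unfolding D4_projective_def by blast

lemma D4_injectiveD:
  "D4_injective I \<Longrightarrow> D4_module M \<Longrightarrow> D4_module N \<Longrightarrow> D4_hom M N g \<Longrightarrow> inj_mat g \<Longrightarrow>
    D4_hom M I f \<Longrightarrow> \<exists>h. D4_hom N I h \<and> h * g = f"
  unfolding D4_injective_def by blast

section \<open>Projective covers and syzygies\<close>

lemma projective_cover_lift:
  assumes pc: "projective_cover M P f" "projective_cover N Q g" and iso: "M \<cong>\<^sub>D N"
  obtains h where "D4_hom P Q h" "surj_mat h" "mat_kernel (g * h) = mat_kernel f"
proof -
  obtain \<phi> \<psi> where M: "D4_module M" and N: "D4_module N" and \<phi>: "D4_hom M N \<phi>"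
    and \<psi>: "D4_hom N M \<psi>" and inv: "\<phi> * \<psi> = 1\<^sub>m (mdim N)" "\<psi> * \<phi> = 1\<^sub>m (mdim M)"
    using D4_isoE[OF iso] .
  have P: "D4_projective P" "D4_module P" "D4_hom P M f" "surj_mat f"
    using pc(1) unfolding projective_cover_def D4_projective_def by auto
  have Q: "D4_module Q" "D4_hom Q N g" "surj_mat g"
    and superfluous: "\<And>L. D4_submodule Q L \<Longrightarrow>
      {u + v | u v. u \<in> L \<and> v \<in> mat_kernel g} = space Q \<Longrightarrow> L = space Q"
    using pc(2) unfolding projective_cover_def D4_projective_def by auto
  obtain h where h: "D4_hom P Q h" and gh: "g * h = \<phi> * f"
    using D4_projectiveD[OF P(1) Q(1) N Q(2,3)] D4_hom_comp[OF P(2) M N P(3) \<phi>] by blast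
  note hc = D4_hom_carrier[OF h] and fc = D4_hom_carrier[OF P(3)] and gc = D4_hom_carrier[OF Q(2)]
    and \<phi>c = D4_hom_carrier[OF \<phi>] and \<psi>c = D4_hom_carrier[OF \<psi>]
  have ghv: "g *\<^sub>v (h *\<^sub>v v) = \<phi> *\<^sub>v (f *\<^sub>v v)" if "v \<in> carrier_vec (mdim P)" for v
    using gh assoc_mult_mat_vec[OF gc hc that] assoc_mult_mat_vec[OF \<phi>c fc that] by simp
  have "w \<in> {u + v | u v. u \<in> mat_image h \<and> v \<in> mat_kernel g}"
    if w: "w \<in> carrier_vec (mdim Q)" for w
  proof -
    \<comment> \<open>Pulling \<open>g *\<^sub>v w\<close> back along \<psi> and then along
      \<open>f\<close> gives \<open>v\<close> such that \<open>h *\<^sub>v v\<close> and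
      \<open>w\<close> agree under \<open>g\<close>; their difference is the kernel component of
      \<open>w\<close>.\<close>
    have \<psi>gw: "\<psi> *\<^sub>v (g *\<^sub>v w) \<in> carrier_vec (mdim M)"
      using w mult_mat_vec_carrier[OF \<psi>c
          mult_mat_vec_carrier[OF gc]] by blast
    obtain v where v: "v \<in> carrier_vec (mdim P)" "f *\<^sub>v v = \<psi> *\<^sub>v (g *\<^sub>v w)"
      using surj_matD[OF P(4) fc, of "\<psi> *\<^sub>v (g *\<^sub>v w)"] \<psi>gw by blast
    have "g *\<^sub>v (h *\<^sub>v v) = g *\<^sub>v w"
      using ghv[OF v(1)] v(2) inv(1) mult_mat_vec_carrier[OF gc w]
        assoc_mult_mat_vec[OF \<phi>c \<psi>c, of "g *\<^sub>v w"]
      by simp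
    moreover have hv: "h *\<^sub>v v \<in> carrier_vec (mdim Q)"
      using v(1) by (rule mult_mat_vec_carrier[OF hc])
    ultimately have "g *\<^sub>v (w - h *\<^sub>v v) = 0\<^sub>v (mdim N)"
      using w mult_minus_distrib_mat_vec[OF gc w hv]
        mult_mat_vec_carrier[OF gc w] by simp
    then have "w - h *\<^sub>v v \<in> mat_kernel g"
      using w hv by (intro mat_kernelI[OF gc]) auto
    moreover have "h *\<^sub>v v \<in> mat_image h"
      using v hc unfolding mat_image_def by auto
    moreover have "w = h *\<^sub>v v + (w - h *\<^sub>v v)"
      using w hv hc by (intro eq_vecI) auto
    ultimately show ?thesis by blast
  qed
  moreover have sub: "D4_submodule Q (mat_image h)"
    by (rule D4_submodule_image[OF P(2) Q(1) h])
  then have "mat_image h \<subseteq> space Q"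
    unfolding D4_submodule_def by simp
  then have "{u + v | u v. u \<in> mat_image h \<and> v \<in> mat_kernel g} \<subseteq> space Q"
    using mat_kernel_carrier[OF gc] by (auto intro!: add_carrier_vec)
  ultimately have "mat_image h = space Q"
    using superfluous[OF sub] by blast
  then have "surj_mat h"
    using hc unfolding surj_mat_def by auto
  \<comment> \<open>Since \<open>g * h = \<phi> * f\<close>, this is the injectivity of
    \<phi>.\<close>
  moreover have "mat_kernel (g * h) = mat_kernel f"
  proof -
    have "\<phi> *\<^sub>v (f *\<^sub>v v) = 0\<^sub>v (mdim N) \<longleftrightarrow> f *\<^sub>v v = 0\<^sub>v (mdim M)"
      if "v \<in> carrier_vec (mdim P)" for v
    proof
      assume "\<phi> *\<^sub>v (f *\<^sub>v v) = 0\<^sub>v (mdim N)"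
      also have "\<dots> = \<phi> *\<^sub>v 0\<^sub>v (mdim M)"
        using \<phi>c by auto
      finally show "f *\<^sub>v v = 0\<^sub>v (mdim M)"
        using that fc inj_matD[OF inj_mat_if_left_inverse[OF \<psi>c \<phi>c inv(2)] \<phi>c] by auto
    qed (use \<phi>c in auto)
    moreover have "\<phi> *\<^sub>v 0\<^sub>v (mdim M) = 0\<^sub>v (mdim N)"
      using \<phi>c by auto
    ultimately show ?thesis
      unfolding gh mat_kernel[OF fc]
        mat_kernel[OF mult_carrier_mat[OF \<phi>c fc]]
      by (auto simp: assoc_mult_mat_vec[OF \<phi>c fc])
  qed
  ultimately show thesis
    using that h by blast
qed

text \<open>The isomorphism \<open>x\<close> is the restriction of \<open>h\<close> to the kernels,
  and \<open>y\<close> is the restriction of its inverse \<open>k\<close>.\<close>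

lemma Syz_unique:
  assumes "Syz M K" "Syz N L" and iso: "M \<cong>\<^sub>D N"
  shows "K \<cong>\<^sub>D L"
proof -
  obtain P f i where K: "D4_module K" and pcP: "projective_cover M P f"
    and i: "D4_hom K P i" "inj_mat i" "mat_image i = mat_kernel f"
    using assms(1) unfolding Syz_def by auto
  obtain Q g j where L: "D4_module L" and pcQ: "projective_cover N Q g"
    and j: "D4_hom L Q j" "inj_mat j" "mat_image j = mat_kernel g"
    using assms(2) unfolding Syz_def by auto
  have P: "D4_module P" "D4_hom P M f" and Q: "D4_module Q" "D4_hom Q N g"
    using pcP pcQ unfolding projective_cover_def D4_projective_def by auto
  obtain h where h: "D4_hom P Q h" "surj_mat h" and ker: "mat_kernel (g * h) = mat_kernel f"
    using projective_cover_lift[OF pcP pcQ iso] .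
  \<comment> \<open>The map in the other direction serves only to equate the dimensions, which makes
    the surjective \<open>h\<close> square and hence invertible.\<close>
  obtain h' where h': "D4_hom Q P h'" "surj_mat h'"
    using projective_cover_lift[OF pcQ pcP D4_iso_sym[OF iso]] by blast
  have dim: "mdim Q = mdim P"
    using surj_mat_dim_le[OF h(2) D4_hom_carrier[OF h(1)]]
      surj_mat_dim_le[OF h'(2) D4_hom_carrier[OF h'(1)]] by simp
  note hc = D4_hom_carrier[OF h(1), unfolded dim]
  note ic = D4_hom_carrier[OF i(1)]
  note jc = D4_hom_carrier[OF j(1), unfolded dim]
  note gc = D4_hom_carrier[OF Q(2), unfolded dim]
  obtain k where k: "k \<in> carrier_mat (mdim P) (mdim P)"
    "h * k = 1\<^sub>m (mdim P)" "k * h = 1\<^sub>m (mdim P)"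
    using surj_mat_square_inverse[OF h(2) hc] .
  \<comment> \<open>The image of \<open>i\<close> is the kernel of \<open>f\<close>, which equals
    that of \<open>g * h\<close>; so \<open>h\<close> sends it into the kernel of \<open>g\<close>,
    the image of \<open>j\<close>.\<close>
  obtain x where x: "x \<in> carrier_mat (mdim L) (mdim K)" "j * x = h * i"
  proof (rule factor_through_image[OF jc, of "h * i" "mdim K"])
    fix v :: "'a vec" assume v: "v \<in> carrier_vec (mdim K)"
    then have "i *\<^sub>v v \<in> mat_kernel (g * h)"
      using ic i(3) unfolding ker by (auto simp: mat_image_def)
    then have "g *\<^sub>v (h *\<^sub>v (i *\<^sub>v v)) = 0\<^sub>v (mdim N)"
      using assoc_mult_mat_vec[OF gc hc, of "i *\<^sub>v v"] mat_kernelD[OF mult_carrier_mat[OF gc hc]]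
        v ic by auto
    then show "(h * i) *\<^sub>v v \<in> mat_image j"
      using assoc_mult_mat_vec[OF hc ic v] v ic hc unfolding j(3)
      by (intro mat_kernelI[OF gc]) auto
  qed (use hc ic in auto)
  obtain y where y: "y \<in> carrier_mat (mdim K) (mdim L)" "i * y = k * j"
  proof (rule factor_through_image[OF ic, of "k * j" "mdim L"])
    fix v :: "'a vec" assume v: "v \<in> carrier_vec (mdim L)"
    have "h *\<^sub>v (k *\<^sub>v (j *\<^sub>v v)) = j *\<^sub>v v"
      using k v jc assoc_mult_mat_vec[OF hc k(1), of "j *\<^sub>v v"] by simp
    moreover have "j *\<^sub>v v \<in> mat_kernel g"
      using v jc unfolding j(3)[symmetric] by (auto simp: mat_image_def)
    ultimately have "(g * h) *\<^sub>v (k *\<^sub>v (j *\<^sub>v v)) = 0\<^sub>v (mdim N)"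
      using assoc_mult_mat_vec[OF gc hc, of "k *\<^sub>v (j *\<^sub>v v)"] mat_kernelD[OF gc] v jc k by auto
    then have "k *\<^sub>v (j *\<^sub>v v) \<in> mat_kernel (g * h)"
      using v jc k by (intro mat_kernelI[OF mult_carrier_mat[OF gc hc]]) auto
    then show "(k * j) *\<^sub>v v \<in> mat_image i"
      using assoc_mult_mat_vec[OF k(1) jc v] unfolding i(3) ker by simp
  qed (use k jc in auto)
  have "x * y = 1\<^sub>m (mdim L)"
  proof (rule inj_mat_cancel[OF j(2) jc])
    have "j * (x * y) = h * (i * y)"
      using assoc_mult_mat[OF jc x(1) y(1)] assoc_mult_mat[OF hc ic y(1)] x(2) by simp
    then show "j * (x * y) = j * 1\<^sub>m (mdim L)"
      using assoc_mult_mat[OF hc k(1) jc] k y(2) jc by simp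
  qed (use x y in auto)
  moreover have "y * x = 1\<^sub>m (mdim K)"
  proof (rule inj_mat_cancel[OF i(2) ic])
    have "i * (y * x) = k * (j * x)"
      using assoc_mult_mat[OF ic y(1) x(1)] assoc_mult_mat[OF k(1) jc x(1)] y(2) by simp
    then show "i * (y * x) = i * 1\<^sub>m (mdim K)"
      using assoc_mult_mat[OF k(1) hc ic] k x(2) ic by simp
  qed (use x y in auto)
  moreover have "D4_hom K L x"
    using D4_hom_lift[OF K L Q(1) D4_hom_comp[OF K P(1) Q(1) i(1) h(1)] j(1,2) x] .
  ultimately show ?thesis
    using D4_isoI[OF K L] y(1) by blast
qed

section \<open>Injective envelopes and cosyzygies\<close>

text \<open>Injectivity of \<open>J\<close> extends \<open>g * \<phi>\<close> along \<open>f\<close>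
  to \<open>h\<close>. Since \<open>g * \<phi>\<close> is injective, the kernel of \<open>h\<close>
  meets the image of \<open>f\<close> trivially; that image is essential, so \<open>h\<close> is
  injective. The square \<open>h * f = g * \<phi>\<close> is kept in the conclusion because it is
  what lets \<open>h\<close> and its inverse pass to the cokernels.\<close>

lemma injective_envelope_extend:
  assumes env: "injective_envelope M I f" "injective_envelope N J g" and iso: "M \<cong>\<^sub>D N"
  obtains h \<phi> \<psi> where "D4_hom I J h" "inj_mat h" "D4_hom M N \<phi>" "D4_hom N M \<psi>"
    "\<phi> * \<psi> = 1\<^sub>m (mdim N)" "h * f = g * \<phi>"
proof -
  obtain \<phi> \<psi> where M: "D4_module M" and N: "D4_module N" and \<phi>: "D4_hom M N \<phi>"
    and \<psi>: "D4_hom N M \<psi>" and inv: "\<phi> * \<psi> = 1\<^sub>m (mdim N)" "\<psi> * \<phi> = 1\<^sub>m (mdim M)"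
    using D4_isoE[OF iso] .
  have I: "D4_module I" "D4_hom M I f" "inj_mat f"
    and essential: "\<And>L. D4_submodule I L \<Longrightarrow> L \<inter> mat_image f = {0\<^sub>v (mdim I)} \<Longrightarrow>
      L = {0\<^sub>v (mdim I)}"
    using env(1) unfolding injective_envelope_def D4_injective_def by auto
  have J: "D4_injective J" "D4_module J" "D4_hom N J g" "inj_mat g"
    using env(2) unfolding injective_envelope_def D4_injective_def by auto
  obtain h where h: "D4_hom I J h" and hf: "h * f = g * \<phi>"
    using D4_injectiveD[OF J(1) M I(1,2,3)] D4_hom_comp[OF M N J(2) \<phi> J(3)] by blast
  note hc = D4_hom_carrier[OF h] and fc = D4_hom_carrier[OF I(2)] and gc = D4_hom_carrier[OF J(3)]
    and \<phi>c = D4_hom_carrier[OF \<phi>] and \<psi>c = D4_hom_carrier[OF \<psi>]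
  have sub: "D4_submodule I (mat_kernel h)"
    by (rule D4_submodule_kernel[OF I(1) J(2) h])
  have "w = 0\<^sub>v (mdim I)" if w: "w \<in> mat_kernel h" "w \<in> mat_image f" for w
  proof -
    obtain v where v: "v \<in> carrier_vec (mdim M)" "w = f *\<^sub>v v"
      using w(2) fc unfolding mat_image_def by auto
    have "g *\<^sub>v (\<phi> *\<^sub>v v) = h *\<^sub>v w"
      using v(2) hf assoc_mult_mat_vec[OF gc \<phi>c v(1)] assoc_mult_mat_vec[OF hc fc v(1)] by simp
    also have "\<dots> = 0\<^sub>v (mdim J)"
      using mat_kernelD[OF hc w(1)] by simp
    also have "\<dots> = g *\<^sub>v 0\<^sub>v (mdim N)"
      using gc by auto
    finally have "\<phi> *\<^sub>v v = 0\<^sub>v (mdim N)"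
      using inj_matD[OF J(4) gc] \<phi>c v(1) by auto
    also have "\<dots> = \<phi> *\<^sub>v 0\<^sub>v (mdim M)"
      using \<phi>c by auto
    finally have "v = 0\<^sub>v (mdim M)"
      using inj_matD[OF inj_mat_if_left_inverse[OF \<psi>c \<phi>c inv(2)] \<phi>c v(1)] by auto
    then show ?thesis
      using v(2) fc by auto
  qed
  moreover have "0\<^sub>v (mdim I) \<in> mat_kernel h" "0\<^sub>v (mdim I) \<in> mat_image f"
    using sub D4_submodule_image[OF M I(1,2)] unfolding D4_submodule_def by auto
  ultimately have "mat_kernel h = {0\<^sub>v (mdim I)}"
    using essential[OF sub] by blast
  then have "inj_mat h"
    by (intro inj_mat_if_kernel_trivial[OF hc]) (use mat_kernelI[OF hc] in blast)
  then show thesis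
    using that[OF h _ \<phi> \<psi> inv(1) hf] by blast
qed

text \<open>Take \<open>x = u * s\<close> for a linear section \<open>s\<close> of \<open>q\<close>.
  The vectors \<open>s *\<^sub>v (q *\<^sub>v v)\<close> and \<open>v\<close> differ by an element
  of the kernel of \<open>q\<close>, which \<open>u\<close> kills.\<close>

lemma factor_through_cokernel:
  fixes q u :: "'k::field mat"
  assumes "surj_mat q" and q: "q \<in> carrier_mat n m" and u: "u \<in> carrier_mat l m"
    and ker: "mat_kernel q \<subseteq> mat_kernel u"
  obtains x where "x \<in> carrier_mat l n" "x * q = u"
proof -
  obtain s where s: "s \<in> carrier_mat m n" "q * s = 1\<^sub>m n"
    using surj_mat_right_inverse[OF assms(1) q] .
  note us = mult_carrier_mat[OF u s(1)]
  have "u * s * q = u"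
  proof (rule mat_eq_if_mult_vec_eq[OF mult_carrier_mat[OF us q] u])
    fix v :: "'k vec" assume v: "v \<in> carrier_vec m"
    define w where "w = s *\<^sub>v (q *\<^sub>v v)"
    have w: "w \<in> carrier_vec m"
      unfolding w_def using s q v by simp
    have "q *\<^sub>v w = q *\<^sub>v v"
      unfolding w_def using assoc_mult_mat_vec[OF q s(1), of "q *\<^sub>v v"] s q v by simp
    then have "q *\<^sub>v (w - v) = 0\<^sub>v n"
      using mult_minus_distrib_mat_vec[OF q w v] q v by simp
    then have "w - v \<in> mat_kernel u"
      using ker w v mat_kernelI[OF q, of "w - v"] by auto
    then have diff: "u *\<^sub>v w - u *\<^sub>v v = 0\<^sub>v l"
      using mat_kernelD[OF u] mult_minus_distrib_mat_vec[OF u w v] by simp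
    have "u *\<^sub>v w = (u *\<^sub>v w - u *\<^sub>v v) + u *\<^sub>v v"
      using u by (intro eq_vecI) auto
    then have "u *\<^sub>v w = u *\<^sub>v v"
      unfolding diff using u v by simp
    then show "u * s * q *\<^sub>v v = u *\<^sub>v v"
      unfolding w_def
      using assoc_mult_mat_vec[OF us q v] assoc_mult_mat_vec[OF u s(1), of "q *\<^sub>v v"] q v by simp
  qed
  then show thesis
    using that us by blast
qed

lemma Cosyz_unique:
  assumes "Cosyz M K" "Cosyz N L" and iso: "M \<cong>\<^sub>D N"
  shows "K \<cong>\<^sub>D L"
proof -
  obtain I f q where K: "D4_module K" and envI: "injective_envelope M I f"
    and q: "D4_hom I K q" "surj_mat q" "mat_kernel q = mat_image f"
    using assms(1) unfolding Cosyz_def by auto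
  obtain J g p where L: "D4_module L" and envJ: "injective_envelope N J g"
    and p: "D4_hom J L p" "surj_mat p" "mat_kernel p = mat_image g"
    using assms(2) unfolding Cosyz_def by auto
  have I: "D4_module I" "D4_hom M I f" and J: "D4_module J" "D4_hom N J g"
    using envI envJ unfolding injective_envelope_def D4_injective_def by auto
  obtain h \<phi> \<psi> where h: "D4_hom I J h" "inj_mat h" and \<phi>: "D4_hom M N \<phi>" and \<psi>: "D4_hom N M \<psi>"
    and inv: "\<phi> * \<psi> = 1\<^sub>m (mdim N)" and hf: "h * f = g * \<phi>"
    using injective_envelope_extend[OF envI envJ iso] .
  obtain h' where h': "D4_hom J I h'" "inj_mat h'"
    using injective_envelope_extend[OF envJ envI D4_iso_sym[OF iso]] by blast
  have dim: "mdim J = mdim I"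
    using inj_mat_dim_le[OF h(2) D4_hom_carrier[OF h(1)]]
      inj_mat_dim_le[OF h'(2) D4_hom_carrier[OF h'(1)]] by simp
  note hc = D4_hom_carrier[OF h(1), unfolded dim]
  note qc = D4_hom_carrier[OF q(1)] and fc = D4_hom_carrier[OF I(2)]
  note pc = D4_hom_carrier[OF p(1), unfolded dim] and gc = D4_hom_carrier[OF J(2), unfolded dim]
  note \<phi>c = D4_hom_carrier[OF \<phi>] and \<psi>c = D4_hom_carrier[OF \<psi>]
  obtain k where k: "k \<in> carrier_mat (mdim I) (mdim I)"
    "h * k = 1\<^sub>m (mdim I)" "k * h = 1\<^sub>m (mdim I)"
    using inj_mat_square_inverse[OF h(2) hc] .
  \<comment> \<open>The inverse of \<open>h\<close> must carry the image of \<open>g\<close> back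
    into that of \<open>f\<close>: inserting \<open>\<phi> * \<psi> = 1\<close> rewrites
    \<open>g\<close> as \<open>h * f * \<psi>\<close>, and \<open>k\<close> cancels
    \<open>h\<close>.\<close>
  have "k * g = k * (g * \<phi> * \<psi>)"
    using assoc_mult_mat[OF gc \<phi>c \<psi>c] inv gc by simp
  also have "\<dots> = k * (h * (f * \<psi>))"
    using assoc_mult_mat[OF hc fc \<psi>c] hf by simp
  also have "\<dots> = f * \<psi>"
    using assoc_mult_mat[OF k(1) hc mult_carrier_mat[OF fc \<psi>c]] k fc \<psi>c by simp
  finally have kg: "k * g = f * \<psi>" .
  obtain x where x: "x \<in> carrier_mat (mdim L) (mdim K)" "x * q = p * h"
  proof (rule factor_through_cokernel[OF q(2) qc, of "p * h" "mdim L"])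
    show "mat_kernel q \<subseteq> mat_kernel (p * h)"
      unfolding q(3)
    proof
      fix w assume "w \<in> mat_image f"
      then obtain v where v: "v \<in> carrier_vec (mdim M)" "w = f *\<^sub>v v"
        using fc unfolding mat_image_def by auto
      have "h *\<^sub>v w = g *\<^sub>v (\<phi> *\<^sub>v v)"
        using v(2) hf assoc_mult_mat_vec[OF gc \<phi>c v(1)] assoc_mult_mat_vec[OF hc fc v(1)] by simp
      then have "h *\<^sub>v w \<in> mat_kernel p"
        unfolding p(3) using gc \<phi>c v(1) by (auto simp: mat_image_def)
      then show "w \<in> mat_kernel (p * h)"
        using mat_kernelD[OF pc] assoc_mult_mat_vec[OF pc hc, of w] v fc
        by (intro mat_kernelI[OF mult_carrier_mat[OF pc hc]]) auto
    qed
  qed (use pc hc in auto)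
  obtain y where y: "y \<in> carrier_mat (mdim K) (mdim L)" "y * p = q * k"
  proof (rule factor_through_cokernel[OF p(2) pc, of "q * k" "mdim K"])
    show "mat_kernel p \<subseteq> mat_kernel (q * k)"
      unfolding p(3)
    proof
      fix w assume "w \<in> mat_image g"
      then obtain v where v: "v \<in> carrier_vec (mdim N)" "w = g *\<^sub>v v"
        using gc unfolding mat_image_def by auto
      have "k *\<^sub>v w = f *\<^sub>v (\<psi> *\<^sub>v v)"
        using v(2) kg assoc_mult_mat_vec[OF fc \<psi>c v(1)] assoc_mult_mat_vec[OF k(1) gc v(1)]
        by simp
      then have "k *\<^sub>v w \<in> mat_kernel q"
        unfolding q(3) using fc \<psi>c v(1) by (auto simp: mat_image_def)
      then show "w \<in> mat_kernel (q * k)"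
        using mat_kernelD[OF qc] assoc_mult_mat_vec[OF qc k(1), of w] v gc
        by (intro mat_kernelI[OF mult_carrier_mat[OF qc k(1)]]) auto
    qed
  qed (use qc k in auto)
  have "x * y = 1\<^sub>m (mdim L)"
  proof (rule surj_mat_cancel[OF p(2) pc])
    have "x * y * p = x * q * k"
      using assoc_mult_mat[OF x(1) y(1) pc] assoc_mult_mat[OF x(1) qc k(1)] y(2) by simp
    then show "x * y * p = 1\<^sub>m (mdim L) * p"
      using assoc_mult_mat[OF pc hc k(1)] k x(2) pc by simp
  qed (use x y in auto)
  moreover have "y * x = 1\<^sub>m (mdim K)"
  proof (rule surj_mat_cancel[OF q(2) qc])
    have "y * x * q = y * p * h"
      using assoc_mult_mat[OF y(1) x(1) qc] assoc_mult_mat[OF y(1) pc hc] x(2) by simp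
    then show "y * x * q = 1\<^sub>m (mdim K) * q"
      using assoc_mult_mat[OF qc k(1) hc] k y(2) qc by simp
  qed (use x y in auto)
  moreover have "D4_hom K L x"
    using D4_hom_descend[OF K L I(1) D4_hom_comp[OF I(1) J(1) L h(1) p(1)] q(1,2) x] .
  ultimately show ?thesis
    using D4_isoI[OF K L] y(1) by blast
qed

text \<open>A relational power peels off its last step: the modules before that step are isomorphic
  by induction, and uniqueness for a single step finishes.\<close>

lemma relpowp_unique_up_to_iso:
  fixes R :: "'k::field d4rep \<Rightarrow> 'k d4rep \<Rightarrow> bool"
  assumes "\<And>M N K L. R M K \<Longrightarrow> R N L \<Longrightarrow> M \<cong>\<^sub>D N \<Longrightarrow> K \<cong>\<^sub>D L"
    and "(R ^^ s) M K" "(R ^^ s) N L" "M \<cong>\<^sub>D N"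
  shows "K \<cong>\<^sub>D L"
  using assms(2,3)
proof (induction s arbitrary: K L)
  case 0
  then show ?case using assms(4) by simp
next
  case (Suc s)
  then show ?case by (auto intro: assms(1))
qed

section \<open>Twisting by a sign\<close>

text \<open>For \<open>e * e = 1\<close> this is restriction along the algebra automorphism of
  \<open>D_4\<close> that fixes \<open>a\<close> and \<open>d\<close> and multiplies
  \<open>b\<close> and \<open>c\<close> by \<open>e\<close>.\<close>

definition twist :: "'k::field \<Rightarrow> 'k d4rep \<Rightarrow> 'k d4rep" where
  "twist e M = \<lparr>mdim = mdim M, actA = actA M, actB = e \<cdot>\<^sub>m actB M, actC = e \<cdot>\<^sub>m actC M, actD = actD M\<rparr>"

lemma twist_simps [simp]:
  "mdim (twist e M) = mdim M" "actA (twist e M) = actA M" "actB (twist e M) = e \<cdot>\<^sub>m actB M"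
  "actC (twist e M) = e \<cdot>\<^sub>m actC M" "actD (twist e M) = actD M"
  unfolding twist_def by simp_all

lemma smult_smult_mat_cancel: "e * e = 1 \<Longrightarrow> e \<cdot>\<^sub>m (e \<cdot>\<^sub>m X) = X" for X :: "'k::field mat"
  by (rule eq_matI) (auto simp: mult.assoc[symmetric])

lemma smult_uminus_mat: "e \<cdot>\<^sub>m (- X) = - (e \<cdot>\<^sub>m X)" for X :: "'k::field mat"
  by (rule eq_matI) auto

lemma twist_twist: "e * e = 1 \<Longrightarrow> twist e (twist e M) = M"
  unfolding twist_def by (simp add: smult_smult_mat_cancel)

text \<open>Each anticommutation relation has one factor \<open>e\<close> on both sides; in
  \<open>b * b\<close>, \<open>c * c\<close> and \<open>b * c\<close> the two factors cancel by
  \<open>e * e = 1\<close>.\<close>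

lemma D4_module_twist:
  assumes "e * e = 1" "D4_module M"
  shows "D4_module (twist e M)"
  using assms(2) D4_module_carrier[OF assms(2)]
  unfolding D4_module_def Let_def twist_simps
  by (simp add: smult_smult_mat_cancel[OF assms(1)] smult_uminus_mat
      mult_smult_distrib[of _ "mdim M" "mdim M" _ "mdim M"]
      mult_smult_assoc_mat[of _ "mdim M" "mdim M" _ "mdim M"])

lemma D4_hom_twist:
  assumes "D4_module M" "D4_module N" "D4_hom M N f"
  shows "D4_hom (twist e M) (twist e N) f"
  using assms(3) D4_module_carrier[OF assms(1)] D4_module_carrier[OF assms(2)]
  unfolding D4_hom_def twist_simps
  by (simp add: mult_smult_distrib[of _ "mdim N" "mdim M" _ "mdim M"]
      mult_smult_assoc_mat[of _ "mdim N" "mdim N" _ "mdim M"])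

lemma D4_submodule_twist:
  fixes M :: "'k::field d4rep"
  assumes "D4_module M" "D4_submodule M L"
  shows "D4_submodule (twist e M) L"
proof -
  have "(e \<cdot>\<^sub>m X) *\<^sub>v v = e \<cdot>\<^sub>v (X *\<^sub>v v)"
    if "X \<in> carrier_mat (mdim M) (mdim M)" "v \<in> carrier_vec (mdim M)" for X and v :: "'k vec"
    using that by (intro eq_vecI) auto
  then show ?thesis
    using assms(2) D4_module_carrier[OF assms(1)] unfolding D4_submodule_def twist_simps
    by (auto simp: subset_iff)
qed

lemma D4_submodule_untwist:
  assumes "e * e = 1" "D4_module M" "D4_submodule (twist e M) L"
  shows "D4_submodule M L"
  using D4_submodule_twist[OF D4_module_twist[OF assms(1,2)] assms(3), of e]
  unfolding twist_twist[OF assms(1)] .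

text \<open>A lifting problem for the twist of \<open>P\<close> becomes, after twisting everything,
  one for \<open>P\<close>; the same matrix \<open>h\<close> solves both.\<close>

lemma D4_projective_twist:
  assumes e: "e * e = 1" and P: "D4_projective P"
  shows "D4_projective (twist e P)"
  unfolding D4_projective_def
proof (intro conjI allI impI; (elim conjE)?)
  have PM: "D4_module P"
    using P unfolding D4_projective_def by simp
  then show PT: "D4_module (twist e P)"
    by (rule D4_module_twist[OF e])
  fix M N g f
  assume M: "D4_module M" and N: "D4_module N" and g: "D4_hom M N g" "surj_mat g"
    and f: "D4_hom (twist e P) N f"
  have "D4_hom P (twist e N) f"
    using D4_hom_twist[OF PT N f, of e] unfolding twist_twist[OF e] .
  then obtain h where h: "D4_hom P (twist e M) h" "g * h = f"
    using D4_projectiveD[OF P D4_module_twist[OF e M] D4_module_twist[OF e N]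
        D4_hom_twist[OF M N g(1)] g(2)] by blast
  have "D4_hom (twist e P) M h"
    using D4_hom_twist[OF PM D4_module_twist[OF e M] h(1), of e] unfolding twist_twist[OF e] .
  then show "\<exists>h. D4_hom (twist e P) M h \<and> g * h = f"
    using h(2) by blast
qed

lemma D4_injective_twist:
  assumes e: "e * e = 1" and I: "D4_injective I"
  shows "D4_injective (twist e I)"
  unfolding D4_injective_def
proof (intro conjI allI impI; (elim conjE)?)
  have IM: "D4_module I"
    using I unfolding D4_injective_def by simp
  then show IT: "D4_module (twist e I)"
    by (rule D4_module_twist[OF e])
  fix M N g f
  assume M: "D4_module M" and N: "D4_module N" and g: "D4_hom M N g" "inj_mat g"
    and f: "D4_hom M (twist e I) f"
  have "D4_hom (twist e M) I f"
    using D4_hom_twist[OF M IT f, of e] unfolding twist_twist[OF e] .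
  then obtain h where h: "D4_hom (twist e N) I h" "h * g = f"
    using D4_injectiveD[OF I D4_module_twist[OF e M] D4_module_twist[OF e N]
        D4_hom_twist[OF M N g(1)] g(2)] by blast
  have "D4_hom N (twist e I) h"
    using D4_hom_twist[OF D4_module_twist[OF e N] IM h(1), of e] unfolding twist_twist[OF e] .
  then show "\<exists>h. D4_hom N (twist e I) h \<and> h * g = f"
    using h(2) by blast
qed

text \<open>The same matrices \<open>f\<close> and \<open>i\<close> witness the twisted statement,
  because kernels, images, injectivity and surjectivity do not involve the actions.\<close>

lemma Syz_twist:
  assumes e: "e * e = 1" and "Syz M K"
  shows "Syz (twist e M) (twist e K)"
proof -
  obtain P f i where K: "D4_module K" and pc: "projective_cover M P f"
    and i: "D4_hom K P i" "inj_mat i" "mat_image i = mat_kernel f"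
    using assms(2) unfolding Syz_def by auto
  have M: "D4_module M" and P: "D4_projective P" "D4_module P"
    using pc unfolding projective_cover_def D4_projective_def by auto
  have "projective_cover (twist e M) (twist e P) f"
    using pc D4_module_twist[OF e M] D4_projective_twist[OF e P(1)] D4_hom_twist[OF P(2) M]
      D4_submodule_untwist[OF e P(2)]
    unfolding projective_cover_def by auto
  then show ?thesis
    using D4_module_twist[OF e K] D4_hom_twist[OF K P(2) i(1)] i(2,3) unfolding Syz_def by blast
qed

lemma Cosyz_twist:
  assumes e: "e * e = 1" and "Cosyz M K"
  shows "Cosyz (twist e M) (twist e K)"
proof -
  obtain I f q where K: "D4_module K" and env: "injective_envelope M I f"
    and q: "D4_hom I K q" "surj_mat q" "mat_kernel q = mat_image f"
    using assms(2) unfolding Cosyz_def by auto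
  have M: "D4_module M" and I: "D4_injective I" "D4_module I"
    using env unfolding injective_envelope_def D4_injective_def by auto
  have "injective_envelope (twist e M) (twist e I) f"
    using env D4_module_twist[OF e M] D4_injective_twist[OF e I(1)] D4_hom_twist[OF M I(2)]
      D4_submodule_untwist[OF e I(2)]
    unfolding injective_envelope_def by auto
  then show ?thesis
    using D4_module_twist[OF e K] D4_hom_twist[OF I(2) K q(1)] q(2,3) unfolding Cosyz_def by blast
qed

lemma relpowp_twist:
  fixes R :: "'k::field d4rep \<Rightarrow> 'k d4rep \<Rightarrow> bool"
  assumes "\<And>M K. R M K \<Longrightarrow> R (twist e M) (twist e K)" "(R ^^ s) M K"
  shows "(R ^^ s) (twist e M) (twist e K)"
  using assms(2) by (induction s arbitrary: K) (auto intro: assms(1))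

section \<open>Tensoring with a one-dimensional module\<close>

text \<open>Of the comultiplications of \<open>a\<close> and \<open>d\<close> only the terms
  \<open>1 \<otimes> a\<close> and \<open>1 \<otimes> d\<close> survive. A Kronecker product with a
  1 by 1 left factor is a scalar multiple of the right factor, so the two modules are equal and not
  merely isomorphic.\<close>

lemma V_tensor_eq_twist:
  assumes "D4_module M"
  shows "V r \<otimes>\<^sub>D M = twist (sgn_bit r) M"
proof -
  have zero: "0\<^sub>m 1 1 \<otimes>\<^sub>k X = 0\<^sub>m n n" if "X \<in> carrier_mat n n" for X :: "'a mat" and n
    using that by (intro eq_matI) (auto simp: kron_def)
  have scalar: "(t \<cdot>\<^sub>m 1\<^sub>m 1) \<otimes>\<^sub>k X = t \<cdot>\<^sub>m X" for t and X :: "'a mat"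
    by (rule eq_matI) (auto simp: kron_def)
  have one: "1\<^sub>m 1 \<otimes>\<^sub>k X = X" for X :: "'a mat"
    by (rule eq_matI) (auto simp: kron_def)
  show ?thesis
    using D4_module_carrier[OF assms]
    unfolding D4_tensor_def twist_def V_def d4rep.simps scalar
    by (simp only: zero one left_add_zero_mat mult_1)
qed

lemma sgn_bit_mult_self: "sgn_bit r * sgn_bit r = (1 :: 'k::field)"
  unfolding sgn_bit_def by simp

lemma sgn_bit_add: "sgn_bit (r + r') = (sgn_bit r * sgn_bit r' :: 'k::field)"
  by (cases r; cases r') (simp_all add: sgn_bit_def)

lemma twist_V: "twist (sgn_bit r) (V r') = (V (r + r') :: 'k::field d4rep)"
  unfolding twist_def V_def sgn_bit_add by (auto intro!: eq_matI)

text \<open>Twisting a whole chain of steps from \<open>V r'\<close> to \<open>X\<close> gives a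
  chain from \<open>V (r + r')\<close> to the twist of \<open>X\<close>, which uniqueness compares
  with \<open>Y\<close>. Abstracting over \<open>R\<close> covers syzygies and cosyzygies at
  once.\<close>

lemma V_tensor_relpowp:
  fixes R :: "'k::field d4rep \<Rightarrow> 'k d4rep \<Rightarrow> bool"
  assumes uniq: "\<And>M N K L. R M K \<Longrightarrow> R N L \<Longrightarrow> M \<cong>\<^sub>D N \<Longrightarrow> K \<cong>\<^sub>D L"
    and tw: "\<And>M K. R M K \<Longrightarrow> R (twist (sgn_bit r) M) (twist (sgn_bit r) K)"
    and X: "(R ^^ s) (V r') X" and Y: "(R ^^ s) (V (r + r')) Y"
  shows "V r \<otimes>\<^sub>D X \<cong>\<^sub>D Y"
proof -
  note unique = relpowp_unique_up_to_iso[of R, OF _ _ _ D4_iso_refl[OF D4_module_V]]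
  \<comment> \<open>Uniqueness applied to \<open>X\<close> against itself yields that
    \<open>X\<close> is a module, since \<open>D4_iso\<close> includes this condition.\<close>
  have "X \<cong>\<^sub>D X"
    by (rule unique[OF _ X X]) (erule (2) uniq)
  then have "V r \<otimes>\<^sub>D X = twist (sgn_bit r) X"
    by (intro V_tensor_eq_twist) (simp add: D4_iso_def)
  moreover have "(R ^^ s) (V (r + r')) (twist (sgn_bit r) X)"
    unfolding twist_V[symmetric] by (rule relpowp_twist[OF _ X]) (rule tw)
  then have "twist (sgn_bit r) X \<cong>\<^sub>D Y"
    by (rule unique[OF _ _ Y, rotated]) (erule (2) uniq)
  ultimately show ?thesis by simp
qed

text \<open>Iterated syzygies are relations, so the isomorphism is asserted for every choice of
  representatives \<open>X\<close> and \<open>Y\<close>.\<close>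

theorem corollary2p3:
  fixes r r' :: bit and s :: nat
  assumes "CHAR('k::alg_closed_field) \<noteq> 2" and "s \<ge> 1"
  shows
    "(\<forall>X Y :: 'k d4rep. (Syz ^^ s) (V r') X \<and> (Syz ^^ s) (V (r + r')) Y \<longrightarrow> V r \<otimes>\<^sub>D X \<cong>\<^sub>D Y) \<and>
     (\<forall>X Y :: 'k d4rep. (Cosyz ^^ s) (V r') X \<and> (Cosyz ^^ s) (V (r + r')) Y \<longrightarrow> V r \<otimes>\<^sub>D X \<cong>\<^sub>D Y)"
proof (intro conjI allI impI; elim conjE)
  fix X Y :: "'k d4rep"
  show "V r \<otimes>\<^sub>D X \<cong>\<^sub>D Y" if "(Syz ^^ s) (V r') X" "(Syz ^^ s) (V (r + r')) Y"
    using V_tensor_relpowp[of Syz] Syz_unique Syz_twist[OF sgn_bit_mult_self] that by blast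
  show "V r \<otimes>\<^sub>D X \<cong>\<^sub>D Y" if "(Cosyz ^^ s) (V r') X" "(Cosyz ^^ s) (V (r + r')) Y"
    using V_tensor_relpowp[of Cosyz] Cosyz_unique Cosyz_twist[OF sgn_bit_mult_self] that by blast
qed

end
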